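(* Let $m,n$ be positive integers, let $\pi\in\mathbb{R}^n$ be a nonnegative vector satisfying $0<\sum_{J\in[n]^{m-1}}\pi_J\le1$, and let $\mathcal{A}^I$ be an interval $B_\pi^{R^I}$-tensor in $T_{m,n}$. If either $m$ is odd, or $m$ is even and $\mathcal{A}^I$ is symmetric, then $\mathcal{A}^I$ is an interval $P$-tensor.
   Context: $[n]=\{1,\dots,n\}$. $T_{m,n}$ is the set of real $m$th-order $n$-dimensional tensors. For $J=(i_2,\dots,i_m)\in[n]^{m-1}$ write $a_{iJ}=a_{ii_2\cdots i_m}$. The $i$th row sum is $R_i(\mathcal{A})=\sum_{J\in[n]^{m-1}}a_{iJ}$. For a nonnegative vector $\pi=(\pi_1,\dots,\pi_n)$, $\pi_J:=\pi_{i_2}\cdots\pi_{i_m}$. A tensor $\mathcal{A}\in T_{m,n}$ is a $B_\pi^R$-tensor (where $\pi$ is a nonnegative vector with $0<\sum_{J\in[n]^{m-1}}\pi_J\le1$ and the superscript $R$ denotes the row sum vector of $\mathcal{A}$ itself) if for all $i\in[n]$: $R_i(\mathcal{A})>0$, and $\pi_JR_i(\mathcal{A})>a_{iJ}$ for all $J\in[n]^{m-1}\setminus\{(i,\dots,i)\}$. For $\underline{\mathcal{A}}\le\overline{\mathcal{A}}$ (componentwise) in $T_{m,n}$, the interval tensor is $\mathcal{A}^I=[\underline{\mathcal{A}},\overline{\mathcal{A}}]=\{\mathcal{A}:\underline{\mathcal{A}}\le\mathcal{A}\le\overline{\mathcal{A}}\}$. It is an interval $B_\pi^{R^I}$-tensor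 if every $\mathcal{A}\in\mathcal{A}^I$ is a $B_\pi^R$-tensor (same $\pi$, with $R=R(\mathcal{A})$). It is symmetric if both its center $(\underline{\mathcal{A}}+\overline{\mathcal{A}})/2$ and its radius $(\overline{\mathcal{A}}-\underline{\mathcal{A}})/2$ are symmetric tensors (entries invariant under all permutations of the indices); tensors in a symmetric $\mathcal{A}^I$ need not be symmetric. For $x\in\mathbb{R}^n$, $(\mathcal{A}x^{m-1})_i=\sum_{i_2,\dots,i_m=1}^na_{ii_2\cdots i_m}x_{i_2}\cdots x_{i_m}$. $\mathcal{A}$ is a $P$-tensor if for every nonzero $x\in\mathbb{R}^n$ there is $i\in[n]$ with $x_i^{m-1}(\mathcal{A}x^{m-1})_i>0$. $\mathcal{A}^I$ is an interval $P$-tensor if every $\mathcal{A}\in\mathcal{A}^I$ is a $P$-tensor. *)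

theory Defs
  imports "HOL-Analysis.Finite_Cartesian_Product" "HOL-Combinatorics.Permutations"
begin

text \<open>
  The index set \<open>[n]\<close> is a finite type \<open>'n\<close>, so that \<open>n = CARD('n)\<close> is an arbitrary positive
  integer. A multi-index is a list over \<open>'n\<close>. A tensor of order \<open>m\<close> is represented by a function
  on lists of which only the values at lists of length \<open>m\<close> are relevant; all notions below take the
  order \<open>m\<close> as an argument and inspect no other values.
\<close>

type_synonym 'n tensor = "'n list \<Rightarrow> real"

definition multi_indices :: "nat \<Rightarrow> 'n::finite list set" where
  "multi_indices k = {J. length J = k}"

definition vec_monom :: "real ^ 'n::finite \<Rightarrow> 'n list \<Rightarrow> real" where
  "vec_monom x J = (\<Prod>j\<leftarrow>J. x $ j)"

definition row_sum :: "nat \<Rightarrow> 'n::finite tensor \<Rightarrow> 'n \<Rightarrow> real" where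
  "row_sum m A i = (\<Sum>J\<in>multi_indices (m - 1). A (i # J))"

definition tensor_apply :: "nat \<Rightarrow> 'n::finite tensor \<Rightarrow> real ^ 'n \<Rightarrow> real ^ 'n" where
  "tensor_apply m A x = (\<chi> i. \<Sum>J\<in>multi_indices (m - 1). A (i # J) * vec_monom x J)"

definition admissible_weight :: "nat \<Rightarrow> real ^ 'n::finite \<Rightarrow> bool" where
  "admissible_weight m \<pi> \<longleftrightarrow>
     (\<forall>i. 0 \<le> \<pi> $ i) \<and>
     0 < (\<Sum>J\<in>multi_indices (m - 1). vec_monom \<pi> J) \<and>
     (\<Sum>J\<in>multi_indices (m - 1). vec_monom \<pi> J) \<le> 1"

definition B_pi_R_tensor :: "nat \<Rightarrow> real ^ 'n::finite \<Rightarrow> 'n tensor \<Rightarrow> bool" where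
  "B_pi_R_tensor m \<pi> A \<longleftrightarrow>
     admissible_weight m \<pi> \<and>
     (\<forall>i. row_sum m A i > 0 \<and>
          (\<forall>J \<in> multi_indices (m - 1) - {replicate (m - 1) i}.
             vec_monom \<pi> J * row_sum m A i > A (i # J)))"

definition P_tensor :: "nat \<Rightarrow> 'n::finite tensor \<Rightarrow> bool" where
  "P_tensor m A \<longleftrightarrow>
     (\<forall>x. x \<noteq> 0 \<longrightarrow> (\<exists>i. (x $ i) ^ (m - 1) * tensor_apply m A x $ i > 0))"

definition symmetric_tensor :: "nat \<Rightarrow> 'n::finite tensor \<Rightarrow> bool" where
  "symmetric_tensor m A \<longleftrightarrow>
     (\<forall>I \<in> multi_indices m. \<forall>p. p permutes {..<m} \<longrightarrow> A (permute_list p I) = A I)"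

definition tensor_le :: "nat \<Rightarrow> 'n::finite tensor \<Rightarrow> 'n tensor \<Rightarrow> bool" where
  "tensor_le m A B \<longleftrightarrow> (\<forall>I \<in> multi_indices m. A I \<le> B I)"

text \<open>An interval tensor is given by its lower and upper bounds \<open>L\<close> and \<open>U\<close>.\<close>

definition interval_tensor :: "nat \<Rightarrow> 'n::finite tensor \<Rightarrow> 'n tensor \<Rightarrow> 'n tensor set" where
  "interval_tensor m L U = {A. tensor_le m L A \<and> tensor_le m A U}"

definition tensor_center :: "'n::finite tensor \<Rightarrow> 'n tensor \<Rightarrow> 'n tensor" where
  "tensor_center L U = (\<lambda>I. (L I + U I) / 2)"

definition tensor_radius :: "'n::finite tensor \<Rightarrow> 'n tensor \<Rightarrow> 'n tensor" where
  "tensor_radius L U = (\<lambda>I. (U I - L I) / 2)"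

definition symmetric_interval_tensor :: "nat \<Rightarrow> 'n::finite tensor \<Rightarrow> 'n tensor \<Rightarrow> bool" where
  "symmetric_interval_tensor m L U \<longleftrightarrow>
     symmetric_tensor m (tensor_center L U) \<and> symmetric_tensor m (tensor_radius L U)"

definition interval_B_pi_R_tensor :: "nat \<Rightarrow> real ^ 'n::finite \<Rightarrow> 'n tensor \<Rightarrow> 'n tensor \<Rightarrow> bool" where
  "interval_B_pi_R_tensor m \<pi> L U \<longleftrightarrow> (\<forall>A \<in> interval_tensor m L U. B_pi_R_tensor m \<pi> A)"

definition interval_P_tensor :: "nat \<Rightarrow> 'n::finite tensor \<Rightarrow> 'n tensor \<Rightarrow> bool" where
  "interval_P_tensor m L U \<longleftrightarrow> (\<forall>A \<in> interval_tensor m L U. P_tensor m A)"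

end

theory Submission imports Defs "HOL-Analysis.Convex" begin

text \<open>
  Write \<open>\<pi>\<^sub>J\<close> and \<open>x\<^sub>J\<close> for the monomials at a multi-index \<open>J\<close>, and \<open>R\<^sub>i\<close> for the row sums.

  For odd \<open>m\<close> every single \<open>B\<^sub>\<pi>\<^sup>R\<close>-tensor \<open>A\<close> is a \<open>P\<close>-tensor. Let \<open>i\<close> maximise \<open>\<bar>x\<^sub>i\<bar>\<close> and put
  \<open>M = x\<^sub>i\<close>\<open>^(m - 1)\<close>, so that \<open>x\<^sub>J \<le> M\<close> for all \<open>J\<close>. With \<open>s = (\<Sum>J. \<pi>\<^sub>J) \<le> 1\<close>, expanding the nonnegative
  sum \<open>\<Sum>J. (\<pi>\<^sub>J R\<^sub>i - a\<^sub>i\<^sub>J) (M - x\<^sub>J)\<close> shows that the \<open>i\<close>th entry of \<open>A x^(m - 1)\<close> is at least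
  \<open>M R\<^sub>i (1 - s) + R\<^sub>i (\<Sum>j. \<pi>\<^sub>j x\<^sub>j)^(m - 1) \<ge> 0\<close>, with strict inequality unless \<open>x\<^sub>J = M\<close> for all \<open>J\<close>,
  in which case the entry is \<open>M R\<^sub>i > 0\<close>.

  For even \<open>m\<close> it suffices that the form \<open>A x^m\<close> is positive for \<open>x \<noteq> 0\<close>. For fixed \<open>x\<close> the form is
  minimised over the interval by choosing each entry as a lower or an upper bound according to
  the sign of \<open>x\<^sub>I\<close>; this vertex is symmetric when the interval is
  (\<open>form_minimiser_symmetric_interval\<close>). So only a symmetric \<open>B\<^sub>\<pi>\<^sup>R\<close>-tensor \<open>A\<close> has to be treated
  (\<open>tensor_form_pos_symmetric\<close>). It is compared with the symmetric tensor \<open>H\<close> whose entry at \<open>I\<close> is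
  \<open>\<pi>\<^sub>I\<close> times the minimum of \<open>R\<^sub>j / \<pi>\<^sub>j\<close> over the indices \<open>j\<close> in \<open>I\<close>:

  \<^item> the form of \<open>H\<close> is nonnegative (\<open>Min_kernel_nonneg\<close>), because a minimum kernel is a nonnegative
    combination of \<open>m\<close>th powers of linear forms;
  \<^item> symmetry of \<open>A\<close> turns the hypothesis into \<open>A < H\<close> off the diagonal
    (\<open>entry_less_min_tensor\<close>);
  \<^item> the row sums of \<open>H\<close> do not exceed those of \<open>A\<close> (\<open>min_tensor_row_sum_le\<close>).

  Hence \<open>A - H\<close> is symmetric with negative off-diagonal entries and nonnegative row sums. By the
  inequality of arithmetic and geometric means its form is nonnegative, and it vanishes only if
  all those inequalities are equalities; in that case \<open>A x^m = (\<Sum>i. R\<^sub>i x\<^sub>i^m) > 0\<close> directly.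
\<close>

section \<open>Sums over multi-indices\<close>

lemma finite_multi_indices [simp]: "finite (multi_indices k :: 'n::finite list set)"
  using finite_lists_length_eq[of "UNIV :: 'n set" k] by (simp add: multi_indices_def)

lemma sum_multi_indices_Suc:
  fixes f :: "'n::finite list \<Rightarrow> real"
  shows "(\<Sum>I\<in>multi_indices (Suc k). f I) = (\<Sum>i\<in>UNIV. \<Sum>J\<in>multi_indices k. f (i # J))"
proof -
  have "(\<Sum>I\<in>multi_indices (Suc k). f I)
      = (\<Sum>(i, J)\<in>UNIV \<times> multi_indices k. f (i # J))"
    by (rule sum.reindex_bij_witness[where i = "\<lambda>(i, J). i # J" and j = "\<lambda>I. (hd I, tl I)"])
       (auto simp: multi_indices_def length_Suc_conv)
  also have "\<dots> = (\<Sum>i\<in>UNIV. \<Sum>J\<in>multi_indices k. f (i # J))"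
    by (simp add: sum.cartesian_product)
  finally show ?thesis .
qed

lemma sum_lists_prod_list:
  fixes y :: "'a \<Rightarrow> real"
  assumes "finite S"
  shows "(\<Sum>I | set I \<subseteq> S \<and> length I = k. \<Prod>j\<leftarrow>I. y j) = (\<Sum>j\<in>S. y j) ^ k"
proof (induction k)
  case 0
  have "{I. set I \<subseteq> S \<and> length I = 0} = {[]}" by auto
  then show ?case by simp
next
  case (Suc k)
  let ?L = "\<lambda>k. {I. set I \<subseteq> S \<and> length I = k}"
  have "(\<Sum>I\<in>?L (Suc k). \<Prod>j\<leftarrow>I. y j)
      = (\<Sum>(i, J)\<in>S \<times> ?L k. \<Prod>j\<leftarrow>i # J. y j)"
    by (rule sum.reindex_bij_witness[where i = "\<lambda>(i, J). i # J" and j = "\<lambda>I. (hd I, tl I)"])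
       (auto simp: length_Suc_conv)
  also have "\<dots> = (\<Sum>i\<in>S. \<Sum>J\<in>?L k. y i * (\<Prod>j\<leftarrow>J. y j))"
    by (simp add: sum.cartesian_product)
  also have "\<dots> = (\<Sum>i\<in>S. y i * (\<Sum>J\<in>?L k. \<Prod>j\<leftarrow>J. y j))"
    by (simp add: sum_distrib_left)
  finally show ?case
    by (simp add: Suc.IH sum_distrib_right)
qed

lemma vec_monom_simps [simp]:
  "vec_monom x [] = 1" "vec_monom x (i # J) = x $ i * vec_monom x J"
  "vec_monom x (replicate k i) = (x $ i) ^ k"
  by (simp_all add: vec_monom_def prod_list_replicate map_replicate)

lemma vec_monom_mset_cong: "mset I = mset J \<Longrightarrow> vec_monom x I = vec_monom x J"
  unfolding vec_monom_def by (metis mset_map prod_mset_prod_list)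

lemma vec_monom_remove1: "j \<in> set I \<Longrightarrow> vec_monom x I = x $ j * vec_monom x (remove1 j I)"
  using vec_monom_mset_cong[of I "j # remove1 j I" x] by simp

lemma vec_monom_nonneg: "(\<And>i. 0 \<le> x $ i) \<Longrightarrow> 0 \<le> vec_monom x I"
  by (induction I) simp_all

lemma vec_monom_zero_iff: "vec_monom x I = 0 \<longleftrightarrow> (\<exists>j\<in>set I. x $ j = 0)"
  by (induction I) simp_all

lemma abs_vec_monom_le:
  assumes "\<And>j. \<bar>x $ j\<bar> \<le> c"
  shows "\<bar>vec_monom x J\<bar> \<le> c ^ length J"
proof (induction J)
  case (Cons j J)
  have "0 \<le> c" using assms[of j] by linarith
  then show ?case using Cons assms[of j] by (simp add: abs_mult mult_mono)
qed simp

lemma vec_monom_mult: "vec_monom x J * vec_monom y J = (\<Prod>j\<leftarrow>J. x $ j * y $ j)"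
  by (induction J) (simp_all add: vec_monom_def mult_ac)

lemma sum_vec_monom_mult:
  fixes x y :: "real ^ 'n::finite"
  shows "(\<Sum>J\<in>multi_indices k. vec_monom x J * vec_monom y J) = (\<Sum>j\<in>UNIV. x $ j * y $ j) ^ k"
  using sum_lists_prod_list[of "UNIV :: 'n set" "\<lambda>j. x $ j * y $ j" k]
  by (simp add: multi_indices_def vec_monom_mult)

section \<open>Odd order\<close>

lemma P_tensor_odd:
  fixes A :: "'n::finite tensor"
  assumes B: "B_pi_R_tensor m \<pi> A" and "odd m"
  shows "P_tensor m A"
  unfolding P_tensor_def
proof (intro allI impI)
  fix x :: "real ^ 'n" assume "x \<noteq> 0"
  define k where "k = m - 1"
  have "even k" using \<open>odd m\<close> by (simp add: k_def)
  obtain i where i: "\<And>j. \<bar>x $ j\<bar> \<le> \<bar>x $ i\<bar>"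
  proof -
    have "Max (range (\<lambda>j. \<bar>x $ j\<bar>)) \<in> range (\<lambda>j. \<bar>x $ j\<bar>)" by (rule Max_in) auto
    then obtain i where "Max (range (\<lambda>j. \<bar>x $ j\<bar>)) = \<bar>x $ i\<bar>" by (metis imageE)
    moreover have "\<bar>x $ j\<bar> \<le> Max (range (\<lambda>j. \<bar>x $ j\<bar>))" for j by (rule Max_ge) auto
    ultimately show ?thesis using that by metis
  qed
  have "x $ i \<noteq> 0"
  proof
    assume "x $ i = 0"
    then have "x = 0" using i by (simp add: vec_eq_iff)
    with \<open>x \<noteq> 0\<close> show False by simp
  qed
  define M where "M = (x $ i) ^ k"
  have "M > 0" using \<open>even k\<close> \<open>x $ i \<noteq> 0\<close> by (simp add: M_def zero_less_power_eq)
  have le: "vec_monom x J \<le> M" if "J \<in> multi_indices k" for J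
    using abs_vec_monom_le[of x "\<bar>x $ i\<bar>" J] i that \<open>even k\<close>
    by (simp add: M_def multi_indices_def power_even_abs)
  define R where "R = row_sum m A i"
  define T where "T = (\<Sum>J\<in>multi_indices k. A (i # J) * vec_monom x J)"
  define s where "s = (\<Sum>J\<in>multi_indices k. vec_monom \<pi> J)"
  have "R > 0" and off: "\<And>J. J \<in> multi_indices k - {replicate k i} \<Longrightarrow> vec_monom \<pi> J * R > A (i # J)"
    and "s \<le> 1"
    using B by (auto simp: B_pi_R_tensor_def admissible_weight_def R_def k_def s_def)
  have R: "R = (\<Sum>J\<in>multi_indices k. A (i # J))" by (simp add: R_def row_sum_def k_def)
  have nn: "0 \<le> (vec_monom \<pi> J * R - A (i # J)) * (M - vec_monom x J)"
    if "J \<in> multi_indices k" for J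
  proof (cases "J = replicate k i")
    case True
    then show ?thesis by (simp add: M_def)
  next
    case False
    then show ?thesis using off[of J] le[of J] that by simp
  qed
  have "T > 0"
  proof (cases "\<forall>J\<in>multi_indices k. vec_monom x J = M")
    case True
    then have "T = R * M" by (simp add: T_def R sum_distrib_right)
    then show ?thesis using \<open>R > 0\<close> \<open>M > 0\<close> by simp
  next
    case False
    then obtain J where J: "J \<in> multi_indices k" "vec_monom x J \<noteq> M" by auto
    then have "J \<noteq> replicate k i" by (auto simp: M_def)
    then have "0 < (vec_monom \<pi> J * R - A (i # J)) * (M - vec_monom x J)"
      using J off[of J] le[of J] by simp
    then have "0 < (\<Sum>J\<in>multi_indices k. (vec_monom \<pi> J * R - A (i # J)) * (M - vec_monom x J))"
      by (intro sum_pos2[OF _ J(1)]) (auto intro: nn)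
    also have "\<dots> = (\<Sum>J\<in>multi_indices k. M * R * vec_monom \<pi> J
        - R * (vec_monom \<pi> J * vec_monom x J) - M * A (i # J) + A (i # J) * vec_monom x J)"
      by (intro sum.cong refl) (simp add: algebra_simps)
    also have "\<dots> = M * R * s - R * (\<Sum>j\<in>UNIV. \<pi> $ j * x $ j) ^ k - M * R + T"
      by (simp add: sum.distrib sum_subtractf s_def T_def R sum_vec_monom_mult
          flip: sum_distrib_left)
    finally have "T > M * R * (1 - s) + R * (\<Sum>j\<in>UNIV. \<pi> $ j * x $ j) ^ k"
      by (simp add: algebra_simps)
    moreover have "0 \<le> M * R * (1 - s)" using \<open>M > 0\<close> \<open>R > 0\<close> \<open>s \<le> 1\<close> by simp
    moreover have "0 \<le> R * (\<Sum>j\<in>UNIV. \<pi> $ j * x $ j) ^ k"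
      using \<open>R > 0\<close> \<open>even k\<close> by (intro mult_nonneg_nonneg zero_le_even_power) auto
    ultimately show ?thesis by linarith
  qed
  then have "(x $ i) ^ (m - 1) * tensor_apply m A x $ i > 0"
    using \<open>M > 0\<close> by (simp add: tensor_apply_def M_def T_def k_def)
  then show "\<exists>i. (x $ i) ^ (m - 1) * tensor_apply m A x $ i > 0" ..
qed

section \<open>Minimum kernels\<close>

text \<open>
  The kernel sending \<open>I\<close> to the minimum of \<open>\<beta>\<close> on \<open>I\<close> is positive semidefinite for even \<open>m\<close>.
  Subtracting \<open>b = min \<beta>\<close> splits off \<open>b\<close> times the \<open>m\<close>th power of \<open>\<Sum>j\<in>S. y j\<close>; what remains is
  the minimum kernel of \<open>\<beta> - b\<close>, supported on a smaller index set.
\<close>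

lemma Min_kernel_nonneg:
  fixes \<beta> y :: "'a \<Rightarrow> real"
  assumes "finite S" "even m" "m > 0" "\<And>j. j \<in> S \<Longrightarrow> 0 \<le> \<beta> j"
  shows "0 \<le> (\<Sum>I | set I \<subseteq> S \<and> length I = m. Min (\<beta> ` set I) * (\<Prod>j\<leftarrow>I. y j))"
  using assms(1,4)
proof (induction S arbitrary: \<beta> rule: finite_psubset_induct)
  case (psubset S)
  let ?L = "\<lambda>S. {I. set I \<subseteq> S \<and> length I = m}"
  show ?case
  proof (cases "S = {}")
    case True
    then show ?thesis using \<open>m > 0\<close> by (intro sum_nonneg) auto
  next
    case False
    define b where "b = Min (\<beta> ` S)"
    have "b \<in> \<beta> ` S" unfolding b_def using False psubset.hyps by (intro Min_in) auto
    then obtain k where k: "k \<in> S" "\<beta> k = b" by auto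
    have b: "b \<le> \<beta> j" if "j \<in> S" for j
      unfolding b_def using psubset.hyps that by (intro Min_le) auto
    have "0 \<le> b" using psubset.prems k by auto
    have fin: "finite (?L S)" using psubset.hyps by (rule finite_lists_length_eq)
    have shift: "Min ((\<lambda>j. \<beta> j - b) ` set I) = Min (\<beta> ` set I) - b" if "I \<in> ?L S" for I
    proof -
      have "set I \<noteq> {}" using that \<open>m > 0\<close> by auto
      then have "Min (\<beta> ` set I) - b = Min ((\<lambda>t. t - b) ` \<beta> ` set I)"
        by (intro mono_Min_commute) (auto intro!: monoI)
      then show ?thesis by (simp add: image_image)
    qed
    \<comment> \<open>Multi-indices through the minimiser \<open>k\<close> drop out of the shifted kernel.\<close>
    have drop: "Min ((\<lambda>j. \<beta> j - b) ` set I) = 0" if "I \<in> ?L S - ?L (S - {k})" for I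
    proof (rule Min_eqI)
      show "0 \<in> (\<lambda>j. \<beta> j - b) ` set I" using that k by force
    qed (use that b in auto)
    have "(\<Sum>I\<in>?L S. Min (\<beta> ` set I) * (\<Prod>j\<leftarrow>I. y j))
        = b * (\<Sum>I\<in>?L S. \<Prod>j\<leftarrow>I. y j)
          + (\<Sum>I\<in>?L S. Min ((\<lambda>j. \<beta> j - b) ` set I) * (\<Prod>j\<leftarrow>I. y j))"
      by (simp add: sum_distrib_left shift left_diff_distrib flip: sum.distrib)
    also have "(\<Sum>I\<in>?L S. Min ((\<lambda>j. \<beta> j - b) ` set I) * (\<Prod>j\<leftarrow>I. y j))
        = (\<Sum>I\<in>?L (S - {k}). Min ((\<lambda>j. \<beta> j - b) ` set I) * (\<Prod>j\<leftarrow>I. y j))"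
      by (rule sum.mono_neutral_right[OF fin]) (use drop in auto)
    finally have eq: "(\<Sum>I\<in>?L S. Min (\<beta> ` set I) * (\<Prod>j\<leftarrow>I. y j))
        = b * (\<Sum>j\<in>S. y j) ^ m
          + (\<Sum>I\<in>?L (S - {k}). Min ((\<lambda>j. \<beta> j - b) ` set I) * (\<Prod>j\<leftarrow>I. y j))"
      by (simp add: sum_lists_prod_list[OF psubset.hyps(1)])
    have "0 \<le> (\<Sum>I\<in>?L (S - {k}). Min ((\<lambda>j. \<beta> j - b) ` set I) * (\<Prod>j\<leftarrow>I. y j))"
      by (rule psubset.IH) (use k b in auto)
    moreover have "0 \<le> b * (\<Sum>j\<in>S. y j) ^ m"
      using \<open>0 \<le> b\<close> \<open>even m\<close> by (intro mult_nonneg_nonneg zero_le_even_power)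
    ultimately show ?thesis using eq by linarith
  qed
qed

section \<open>Symmetric tensors of even order\<close>

text \<open>The homogeneous polynomial \<open>A x^m\<close> of degree \<open>m\<close> attached to a tensor of order \<open>m\<close>.\<close>

definition tensor_form :: "nat \<Rightarrow> 'n::finite tensor \<Rightarrow> real ^ 'n \<Rightarrow> real" where
  "tensor_form m A x = (\<Sum>I\<in>multi_indices m. A I * vec_monom x I)"

lemma tensor_form_eq_inner_apply:
  assumes "m > 0"
  shows "tensor_form m A x = (\<Sum>i\<in>UNIV. x $ i * tensor_apply m A x $ i)"
proof -
  obtain k where "m = Suc k" using assms by (cases m) auto
  then show ?thesis
    by (simp add: tensor_form_def sum_multi_indices_Suc tensor_apply_def sum_distrib_left mult_ac)
qed

lemma P_tensor_if_form_pos: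
  assumes "even m" "m > 0" and pos: "\<And>x. x \<noteq> 0 \<Longrightarrow> 0 < tensor_form m A x"
  shows "P_tensor m A"
  unfolding P_tensor_def
proof (intro allI impI)
  fix x :: "real ^ 'a" assume "x \<noteq> 0"
  then have "0 < (\<Sum>i\<in>UNIV. x $ i * tensor_apply m A x $ i)"
    using pos tensor_form_eq_inner_apply[OF \<open>m > 0\<close>] by metis
  then obtain i where "0 < x $ i * tensor_apply m A x $ i"
    by (meson not_le sum_nonpos)
  moreover have "odd (m - 1)" using assms by simp
  ultimately have "0 < (x $ i) ^ (m - 1) * tensor_apply m A x $ i"
    by (auto simp: zero_less_mult_iff zero_less_power_eq power_less_zero_eq)
  then show "\<exists>i. 0 < (x $ i) ^ (m - 1) * tensor_apply m A x $ i" ..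
qed

lemma symmetric_tensor_mset_iff:
  "symmetric_tensor m A \<longleftrightarrow>
     (\<forall>I J. length I = m \<longrightarrow> mset I = mset J \<longrightarrow> A I = A J)"
proof
  assume A: "symmetric_tensor m A"
  show "\<forall>I J. length I = m \<longrightarrow> mset I = mset J \<longrightarrow> A I = A J"
  proof (intro allI impI)
    fix I J :: "'a list" assume I: "length I = m" and eq: "mset I = mset J"
    obtain p where p: "p permutes {..<length J}" "permute_list p J = I"
      using mset_eq_permutation[OF eq] by metis
    have J: "length J = m" using I mset_eq_length[OF eq] by simp
    then have "A (permute_list p J) = A J"
      using A p(1) unfolding symmetric_tensor_def multi_indices_def by blast
    then show "A I = A J" using p(2) by simp
  qed
next
  assume A: "\<forall>I J. length I = m \<longrightarrow> mset I = mset J \<longrightarrow> A I = A J"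
  show "symmetric_tensor m A"
    unfolding symmetric_tensor_def multi_indices_def
  proof (intro ballI allI impI)
    fix I :: "'a list" and p assume "I \<in> {J. length J = m}" "p permutes {..<m}"
    then show "A (permute_list p I) = A I"
      by (intro A[rule_format]) auto
  qed
qed

text \<open>All index positions contribute equally to sums against a symmetric tensor.\<close>

lemma symmetric_tensor_sum_nth:
  fixes f :: "'n::finite \<Rightarrow> real"
  assumes D: "symmetric_tensor m D" and "k < m"
  shows "(\<Sum>I\<in>multi_indices m. D I * f (I ! k)) = (\<Sum>I\<in>multi_indices m. D I * f (I ! 0))"
proof -
  define p where "p = transpose 0 k"
  have p: "p permutes {..<m}"
    unfolding p_def using \<open>k < m\<close> by (intro permutes_swap_id) auto
  have inv: "permute_list p (permute_list p I) = I" if "length I = m" for I :: "'n list"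
    using permute_list_compose[of p I p] p that by (simp add: p_def)
  have nth: "permute_list p I ! k = I ! 0" if "length I = m" for I :: "'n list"
    using permute_list_nth[of p I k] p that \<open>k < m\<close> by (simp add: p_def)
  have nth0: "permute_list p I ! 0 = I ! k" if "length I = m" for I :: "'n list"
    using permute_list_nth[of p I 0] p that \<open>k < m\<close> by (simp add: p_def)
  show ?thesis
    by (rule sum.reindex_bij_witness[where i = "permute_list p" and j = "permute_list p"])
       (use D p in \<open>auto simp: inv nth nth0 multi_indices_def symmetric_tensor_def\<close>)
qed

lemma vec_monom_le_mean_power:
  assumes "even m" "m > 0" "length I = m"
  shows "vec_monom x I \<le> (\<Sum>k<m. (x $ (I ! k)) ^ m) / m"
proof -
  define P where "P = (\<Prod>k<m. \<bar>x $ (I ! k)\<bar>)"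
  have "P \<ge> 0" by (simp add: P_def prod_nonneg)
  have "vec_monom x I = (\<Prod>k<m. x $ (I ! k))"
    using assms(3) by (simp add: vec_monom_def prod.list_conv_set_nth lessThan_atLeast0)
  then have "vec_monom x I \<le> P" unfolding P_def by (metis abs_ge_self abs_prod)
  also have "P = (P ^ m) powr (1 / m)"
    using \<open>P \<ge> 0\<close> \<open>m > 0\<close> by (cases "P = 0") (auto simp: powr_powr simp flip: powr_realpow)
  also have "P ^ m = (\<Prod>k<m. (x $ (I ! k)) ^ m)"
    using \<open>even m\<close> by (simp add: P_def power_even_abs flip: prod_power_distrib abs_prod)
  also have "(\<Prod>k<m. (x $ (I ! k)) ^ m) powr (1 / m) \<le> (\<Sum>k<m. (x $ (I ! k)) ^ m / m)"
    using arith_geom_mean[of "{..<m}" "\<lambda>k. (x $ (I ! k)) ^ m"] \<open>even m\<close> \<open>m > 0\<close>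
    by (simp add: zero_le_even_power lessThan_empty_iff)
  finally show ?thesis by (simp add: sum_divide_distrib)
qed

text \<open>
  The comparison tensor with entries \<open>\<pi>\<^sub>I min {r\<^sub>j / \<pi>\<^sub>j | j occurs in I}\<close>. If \<open>\<pi>\<^sub>j = 0\<close> for some \<open>j\<close> in \<open>I\<close>,
  the quotient takes the default value \<open>0\<close>, and the entry is \<open>0\<close> because \<open>\<pi>\<^sub>I = 0\<close>.
\<close>

definition min_tensor :: "real ^ 'n::finite \<Rightarrow> ('n \<Rightarrow> real) \<Rightarrow> 'n tensor" where
  "min_tensor \<pi> r I = vec_monom \<pi> I * Min ((\<lambda>j. r j / \<pi> $ j) ` set I)"

lemma symmetric_min_tensor: "symmetric_tensor m (min_tensor \<pi> r)"
  by (auto simp: symmetric_tensor_mset_iff min_tensor_def dest: mset_eq_setD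
      intro!: arg_cong2[where f = "(*)"] vec_monom_mset_cong)

lemma min_tensor_form_nonneg:
  fixes \<pi> :: "real ^ 'n::finite"
  assumes "even m" "m > 0" "\<And>j. 0 \<le> \<pi> $ j" "\<And>j. 0 \<le> r j"
  shows "0 \<le> tensor_form m (min_tensor \<pi> r) x"
proof -
  have "0 \<le> (\<Sum>I | set I \<subseteq> UNIV \<and> length I = m.
      Min ((\<lambda>j. r j / \<pi> $ j) ` set I) * (\<Prod>j\<leftarrow>I. \<pi> $ j * x $ j))"
    by (rule Min_kernel_nonneg) (use assms in auto)
  also have "\<dots> = tensor_form m (min_tensor \<pi> r) x"
    by (simp add: tensor_form_def min_tensor_def multi_indices_def mult_ac flip: vec_monom_mult)
  finally show ?thesis .
qed

lemma min_tensor_row_sum_le: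
  fixes \<pi> :: "real ^ 'n::finite"
  assumes \<pi>: "admissible_weight m \<pi>" and r: "\<And>j. 0 \<le> r j"
  shows "row_sum m (min_tensor \<pi> r) i \<le> r i"
proof -
  have \<pi>0: "0 \<le> \<pi> $ j" for j using \<pi> by (simp add: admissible_weight_def)
  have "min_tensor \<pi> r (i # J) \<le> vec_monom \<pi> J * r i" for J
  proof (cases "\<pi> $ i = 0")
    case True
    then show ?thesis using vec_monom_nonneg[of \<pi> J] \<pi>0 r by (simp add: min_tensor_def)
  next
    case False
    have "Min ((\<lambda>j. r j / \<pi> $ j) ` set (i # J)) \<le> r i / \<pi> $ i"
      by (rule Min_le) auto
    then have "min_tensor \<pi> r (i # J) \<le> vec_monom \<pi> (i # J) * (r i / \<pi> $ i)"
      unfolding min_tensor_def by (rule mult_left_mono) (simp only: vec_monom_nonneg \<pi>0)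
    then show ?thesis using False by simp
  qed
  then have "row_sum m (min_tensor \<pi> r) i \<le> (\<Sum>J\<in>multi_indices (m - 1). vec_monom \<pi> J * r i)"
    unfolding row_sum_def by (rule sum_mono)
  also have "\<dots> = (\<Sum>J\<in>multi_indices (m - 1). vec_monom \<pi> J) * r i"
    by (simp add: sum_distrib_right)
  also have "\<dots> \<le> r i"
    using \<pi> r[of i] by (simp add: admissible_weight_def mult_left_le_one_le sum_nonneg)
  finally show ?thesis .
qed

text \<open>
  By symmetry any index \<open>j\<close> of \<open>I\<close> can be moved to the front, so the row condition bounds \<open>A I\<close>
  through every \<open>R\<^sub>j\<close> with \<open>j\<close> in \<open>I\<close>, and in particular through the one attaining the minimum.
\<close>

lemma entry_less_min_tensor:
  fixes A :: "'n::finite tensor"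
  assumes B: "B_pi_R_tensor m \<pi> A" and A: "symmetric_tensor m A"
    and I: "length I = m" "\<And>i. I \<noteq> replicate m i" and "m > 0"
  shows "A I < min_tensor \<pi> (row_sum m A) I"
proof -
  define R where "R = row_sum m A"
  have less: "A I < vec_monom \<pi> (remove1 j I) * R j" if j: "j \<in> set I" for j
  proof -
    have "length (remove1 j I) = m - 1" using I j by (simp add: length_remove1)
    moreover have "remove1 j I \<noteq> replicate (m - 1) j"
    proof
      assume "remove1 j I = replicate (m - 1) j"
      then have "set (remove1 j I) \<subseteq> {j}" by auto
      then have "set I \<subseteq> {j}" using in_set_remove1[of _ j I] by blast
      then have "I = replicate m j" using I(1) by (intro replicate_eqI) auto
      with I(2) show False by blast
    qed
    moreover have "A I = A (j # remove1 j I)"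
      by (rule A[unfolded symmetric_tensor_mset_iff, rule_format]) (use I(1) j in auto)
    moreover have "A (j # J) < vec_monom \<pi> J * R j"
      if "length J = m - 1" "J \<noteq> replicate (m - 1) j" for J
      using B that by (auto simp: B_pi_R_tensor_def multi_indices_def R_def)
    ultimately show ?thesis by metis
  qed
  have "I \<noteq> []" using I \<open>m > 0\<close> by auto
  show ?thesis
  proof (cases "vec_monom \<pi> I = 0")
    case True
    \<comment> \<open>Moving an index other than \<open>z\<close> to the front leaves a vanishing weight behind, so \<open>A I < 0\<close>.\<close>
    then obtain z where z: "z \<in> set I" "\<pi> $ z = 0" by (auto simp: vec_monom_zero_iff)
    obtain j where j: "j \<in> set I" "j \<noteq> z"
    proof (rule ccontr)
      assume "\<not> thesis"
      then have "I = replicate m z" using that I(1) by (intro replicate_eqI) auto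
      with I(2) show False by blast
    qed
    then have "z \<in> set (remove1 j I)" using z by simp
    then have "vec_monom \<pi> (remove1 j I) = 0" using z by (auto simp: vec_monom_zero_iff)
    then show ?thesis using less[OF j(1)] True by (simp add: min_tensor_def)
  next
    case False
    have "Min ((\<lambda>j. R j / \<pi> $ j) ` set I) \<in> (\<lambda>j. R j / \<pi> $ j) ` set I"
      using \<open>I \<noteq> []\<close> by (intro Min_in) auto
    then obtain j where j: "j \<in> set I" "Min ((\<lambda>j. R j / \<pi> $ j) ` set I) = R j / \<pi> $ j"
      by auto
    moreover have "\<pi> $ j \<noteq> 0" using False j by (auto simp: vec_monom_zero_iff)
    ultimately have "min_tensor \<pi> R I = vec_monom \<pi> (remove1 j I) * R j"
      by (simp add: min_tensor_def vec_monom_remove1[OF j(1)])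
    then show ?thesis using less[OF j(1)] by (simp add: R_def)
  qed
qed

text \<open>
  With \<open>D = H - A\<close> and \<open>q\<^sub>I\<close> the mean of the powers \<open>x\<^sub>j^m\<close> over the entries \<open>j\<close> of \<open>I\<close>, the sum
  \<open>\<Sum>I. D\<^sub>I (q\<^sub>I - x\<^sub>I)\<close> is nonnegative, while symmetry turns \<open>\<Sum>I. D\<^sub>I q\<^sub>I\<close> into a combination of the
  row sums of \<open>D\<close>, which are at most \<open>0\<close>. So the form of \<open>A\<close> dominates that of \<open>H\<close>.
\<close>

lemma tensor_form_pos_symmetric:
  fixes A :: "'n::finite tensor"
  assumes B: "B_pi_R_tensor m \<pi> A" and A: "symmetric_tensor m A"
    and "even m" "m > 0" "x \<noteq> 0"
  shows "0 < tensor_form m A x"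
proof -
  define R where "R = row_sum m A"
  have adm: "admissible_weight m \<pi>" and Rpos: "\<And>i. R i > 0"
    using B by (auto simp: B_pi_R_tensor_def R_def)
  define q where "q I = (\<Sum>k<m. (x $ (I ! k)) ^ m) / m" for I
  have q: "vec_monom x I \<le> q I" if "I \<in> multi_indices m" for I
    using vec_monom_le_mean_power[of m I x] assms that by (simp add: q_def multi_indices_def)
  have q_sum: "(\<Sum>I\<in>multi_indices m. D I * q I) = (\<Sum>i\<in>UNIV. (x $ i) ^ m * row_sum m D i)"
    if D: "symmetric_tensor m D" for D
  proof -
    have "(\<Sum>I\<in>multi_indices m. D I * q I)
        = (\<Sum>k<m. \<Sum>I\<in>multi_indices m. D I * (x $ (I ! k)) ^ m) / m"
      by (subst sum.swap) (simp add: q_def sum_distrib_left sum_divide_distrib)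
    also have "\<dots> = (\<Sum>I\<in>multi_indices m. D I * (x $ (I ! 0)) ^ m)"
    proof -
      have "(\<Sum>k<m. \<Sum>I\<in>multi_indices m. D I * (x $ (I ! k)) ^ m)
          = (\<Sum>k<m. \<Sum>I\<in>multi_indices m. D I * (x $ (I ! 0)) ^ m)"
        by (intro sum.cong refl symmetric_tensor_sum_nth[OF D, where f = "\<lambda>i. (x $ i) ^ m"]) simp
      then show ?thesis using \<open>m > 0\<close> by simp
    qed
    also have "\<dots> = (\<Sum>I\<in>multi_indices (Suc (m - 1)). D I * (x $ (I ! 0)) ^ m)"
      using \<open>m > 0\<close> by simp
    also have "\<dots> = (\<Sum>i\<in>UNIV. (x $ i) ^ m * row_sum m D i)"
      unfolding sum_multi_indices_Suc by (simp add: row_sum_def sum_distrib_left mult_ac)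
    finally show ?thesis .
  qed
  show ?thesis
  proof (cases "\<forall>I\<in>multi_indices m. vec_monom x I = q I")
    case True
    then have "tensor_form m A x = (\<Sum>i\<in>UNIV. (x $ i) ^ m * R i)"
      by (simp add: tensor_form_def R_def q_sum[OF A])
    moreover obtain i where "x $ i \<noteq> 0" using \<open>x \<noteq> 0\<close> by (auto simp: vec_eq_iff)
    moreover have "0 < (\<Sum>i\<in>UNIV. (x $ i) ^ m * R i)"
      using \<open>x $ i \<noteq> 0\<close> \<open>even m\<close> Rpos
      by (intro sum_pos2[of _ i]) (auto simp: zero_less_power_eq less_imp_le)
    ultimately show ?thesis by simp
  next
    case False
    then obtain I0 where I0: "I0 \<in> multi_indices m" "vec_monom x I0 \<noteq> q I0" by auto
    define H where "H = min_tensor \<pi> R"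
    define D where "D I = H I - A I" for I
    have D: "symmetric_tensor m D"
      using A symmetric_min_tensor[of m \<pi> R] by (simp add: D_def H_def symmetric_tensor_def)
    have diag: "vec_monom x (replicate m i) = q (replicate m i)" for i
      using \<open>m > 0\<close> by (simp add: q_def)
    have Dpos: "0 < D I" if "I \<in> multi_indices m" "\<And>i. I \<noteq> replicate m i" for I
      using entry_less_min_tensor[OF B A _ that(2)] that(1) \<open>m > 0\<close>
      by (simp add: D_def H_def R_def multi_indices_def)
    have nn: "0 \<le> D I * (q I - vec_monom x I)" if "I \<in> multi_indices m" for I
    proof (cases "\<exists>i. I = replicate m i")
      case True
      then show ?thesis using diag by auto
    next
      case False
      then show ?thesis using Dpos[OF that] q[OF that] by (simp add: less_imp_le)
    qed
    have "0 < D I0 * (q I0 - vec_monom x I0)"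
      using Dpos[of I0] q[of I0] I0 diag by (metis diff_gt_0_iff_gt less_le mult_pos_pos)
    then have "0 < (\<Sum>I\<in>multi_indices m. D I * (q I - vec_monom x I))"
      by (intro sum_pos2[OF _ I0(1)]) (auto intro: nn)
    also have "\<dots> = (\<Sum>i\<in>UNIV. (x $ i) ^ m * row_sum m D i) - tensor_form m D x"
      by (simp add: right_diff_distrib sum_subtractf q_sum[OF D] tensor_form_def)
    also have "(\<Sum>i\<in>UNIV. (x $ i) ^ m * row_sum m D i) \<le> 0"
    proof (rule sum_nonpos)
      fix i
      have "row_sum m D i = row_sum m H i - R i"
        by (simp add: row_sum_def D_def R_def sum_subtractf)
      also have "\<dots> \<le> 0"
        using min_tensor_row_sum_le[OF adm, of R i] Rpos by (simp add: H_def less_imp_le)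
      finally show "(x $ i) ^ m * row_sum m D i \<le> 0"
        using \<open>even m\<close> by (simp add: mult_nonneg_nonpos zero_le_even_power)
    qed
    also have "tensor_form m D x = tensor_form m H x - tensor_form m A x"
      by (simp add: tensor_form_def D_def left_diff_distrib sum_subtractf)
    finally have "tensor_form m H x < tensor_form m A x" by simp
    moreover have "0 \<le> tensor_form m H x"
      unfolding H_def using assms adm Rpos
      by (intro min_tensor_form_nonneg) (auto simp: admissible_weight_def less_imp_le)
    ultimately show ?thesis by simp
  qed
qed

section \<open>Interval tensors\<close>

lemma symmetric_interval_bounds:
  assumes "symmetric_interval_tensor m L U"
  shows "symmetric_tensor m L" "symmetric_tensor m U"
proof -
  have "L I = tensor_center L U I - tensor_radius L U I"
       "U I = tensor_center L U I + tensor_radius L U I" for I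
    by (simp_all add: tensor_center_def tensor_radius_def field_simps)
  then show "symmetric_tensor m L" "symmetric_tensor m U"
    using assms unfolding symmetric_interval_tensor_def symmetric_tensor_def by metis+
qed

lemma form_minimiser_symmetric_interval:
  fixes L U :: "'n::finite tensor"
  assumes "symmetric_interval_tensor m L U" "tensor_le m L U"
  obtains V where "V \<in> interval_tensor m L U" "symmetric_tensor m V"
    "\<And>A. A \<in> interval_tensor m L U \<Longrightarrow> tensor_form m V x \<le> tensor_form m A x"
proof
  \<comment> \<open>The form is linear in the entry at \<open>I\<close>, with slope \<open>x\<^sub>I\<close>.\<close>
  define V where "V I = (if 0 \<le> vec_monom x I then L I else U I)" for I
  show "V \<in> interval_tensor m L U"
    using assms(2) by (auto simp: interval_tensor_def tensor_le_def V_def)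
  show "symmetric_tensor m V"
    unfolding symmetric_tensor_mset_iff
  proof (intro allI impI)
    fix I J :: "'n list" assume "length I = m" "mset I = mset J"
    then show "V I = V J"
      using symmetric_interval_bounds[OF assms(1)] vec_monom_mset_cong[of I J x]
      by (simp add: V_def symmetric_tensor_mset_iff)
  qed
  show "tensor_form m V x \<le> tensor_form m A x" if "A \<in> interval_tensor m L U" for A
    unfolding tensor_form_def
    using that
    by (intro sum_mono)
       (auto simp: V_def interval_tensor_def tensor_le_def mult_right_mono mult_right_mono_neg)
qed

theorem corollary4p1:
  fixes m :: nat
    and \<pi> :: "real ^ 'n::finite"
    and L U :: "'n tensor"
  assumes "m \<ge> 1"
    and "admissible_weight m \<pi>"
    and "tensor_le m L U"
    and "interval_B_pi_R_tensor m \<pi> L U"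
    and "odd m \<or> (even m \<and> symmetric_interval_tensor m L U)"
  shows "interval_P_tensor m L U"
  unfolding interval_P_tensor_def
proof
  fix A assume A: "A \<in> interval_tensor m L U"
  have B: "B_pi_R_tensor m \<pi> C" if "C \<in> interval_tensor m L U" for C
    using assms(4) that by (simp add: interval_B_pi_R_tensor_def)
  show "P_tensor m A"
  proof (cases "odd m")
    case True
    then show ?thesis using B[OF A] by (rule P_tensor_odd[rotated])
  next
    case False
    then have "even m" and sym: "symmetric_interval_tensor m L U" using assms(5) by auto
    have "m > 0" using assms(1) by simp
    show ?thesis
    proof (rule P_tensor_if_form_pos[OF \<open>even m\<close> \<open>m > 0\<close>])
      fix x :: "real ^ 'n" assume "x \<noteq> 0"
      obtain V where V: "V \<in> interval_tensor m L U" "symmetric_tensor m V"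
        "\<And>C. C \<in> interval_tensor m L U \<Longrightarrow> tensor_form m V x \<le> tensor_form m C x"
        using form_minimiser_symmetric_interval[OF sym assms(3)] by metis
      have "0 < tensor_form m V x"
        using tensor_form_pos_symmetric[OF B V(2)] V(1) \<open>even m\<close> \<open>m > 0\<close> \<open>x \<noteq> 0\<close> by blast
      also have "\<dots> \<le> tensor_form m A x" using V(3) A by blast
      finally show "0 < tensor_form m A x" .
    qed
  qed
qed

end
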